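(* Let $(X,d_X)$ be a metric space, let $d\in\mathcal M(X)$, and suppose that $[d]\in M(X)$ is invertible. Then there exists an almost isometry $f$ of $X$ such that $[d^f]=[d]$.
   Context: Let $(X,d_X)$ be a metric space. Write $x$ for $(x,0)$ and $x'$ for $(x,1)$ in $X\times\{0,1\}$. $\mathcal M(X)$ is the set of all metrics $d$ on $X\times\{0,1\}$ (metrics on the double of $X$) whose restriction to each of the two copies of $X$ equals $d_X$ and for which $\inf_{x,y\in X}d(x,y')>0$. Equivalence: $d_1\sim d_2$ if there exist $\alpha>0$, $\beta\ge 1$ with $-\alpha+\frac1\beta d_1(x,y')\le d_2(x,y')\le\alpha+\beta d_1(x,y')$ for all $x,y\in X$. $[d]$ is the class of $d$ and $M(X)=\mathcal M(X)/\sim$. Composition: $\rho d(x,z')=\inf_{y\in X}[d(x,y')+\rho(y,z')]$ defines $\rho d\in\mathcal M(X)$, and $[\rho][d]=[\rho d]$ makes $M(X)$ a semigroup. The adjoint $d^*\in\mathcal M(X)$ is $d^*(x,y')=d(y,x')$. The metric $I\in\mathcal M(X)$ is $I(x,y')=d_X(x,y)+1$; $[I]$ is the unit of $M(X)$. An element $[d]\in M(X)$ is invertible if $[d^*d]=[dd^*]=[I]$. A map $f:X\to X$ is an almost isometry if (i1) there exists $C>0$ such that $d_X(x,\tilde x)-C\le d_X(f(x),f(\tilde x))\le d_X(x,\tilde x)+C$ for all $x,\tilde x\in X$; and (i2) there exist a map $g:X\to X$ and $D>0$ such that $d_X(g(f(x)),x)<D$ and $d_X(f(g(x)),x)<D$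 for all $x\in X$. For an almost isometry $f$, with $C$ a constant as in (i1), the metric $d^f\in\mathcal M(X)$ is defined by $d^f(x,y')=\inf_{z\in X}[d_X(x,z)+C+d_X(f(z),y)]$, $x,y\in X$ (its class $[d^f]$ does not depend on the choice of $C$). *)

theory Defs
  imports "HOL-Analysis.Analysis"
begin

section \<open>Metrics on the double of a metric space\<close>

text \<open>
  The metric space \<open>X\<close> is a type \<open>'a\<close> of class \<open>metric_space\<close>, with \<open>dist\<close> in the role of \<open>d_X\<close>.
  Its double is \<open>'a \<times> bool\<close>: the point \<open>x\<close> is \<open>(x, False)\<close> and \<open>x'\<close> is \<open>(x, True)\<close>.
\<close>

definition double_metrics :: "('a::metric_space \<times> bool \<Rightarrow> 'a \<times> bool \<Rightarrow> real) set" where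
  "double_metrics =
    {d. Metric_space UNIV d \<and>
        (\<forall>x y. d (x, False) (y, False) = dist x y) \<and>
        (\<forall>x y. d (x, True) (y, True) = dist x y) \<and>
        (INF p. d (fst p, False) (snd p, True)) > 0}"

text \<open>
  An element \<open>d\<close> of \<open>double_metrics\<close> is determined by its values \<open>c x y = d(x, y')\<close>, and
  \<open>double c\<close> recovers it from them.
\<close>

definition double ::
    "('a::metric_space \<Rightarrow> 'a \<Rightarrow> real) \<Rightarrow> 'a \<times> bool \<Rightarrow> 'a \<times> bool \<Rightarrow> real" where
  "double c = (\<lambda>(x, i) (y, j). if i = j then dist x y else if j then c x y else c y x)"

definition dm_rel ::
    "(('a::metric_space \<times> bool \<Rightarrow> 'a \<times> bool \<Rightarrow> real) \<times> ('a \<times> bool \<Rightarrow> 'a \<times> bool \<Rightarrow> real)) set" where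
  "dm_rel =
    {(d1, d2). d1 \<in> double_metrics \<and> d2 \<in> double_metrics \<and>
      (\<exists>\<alpha>>0. \<exists>\<beta>\<ge>1. \<forall>x y.
        - \<alpha> + 1 / \<beta> * d1 (x, False) (y, True) \<le> d2 (x, False) (y, True) \<and>
        d2 (x, False) (y, True) \<le> \<alpha> + \<beta> * d1 (x, False) (y, True))}"

definition dm_class ::
    "('a::metric_space \<times> bool \<Rightarrow> 'a \<times> bool \<Rightarrow> real) \<Rightarrow> ('a \<times> bool \<Rightarrow> 'a \<times> bool \<Rightarrow> real) set" where
  "dm_class d = dm_rel `` {d}"

definition dm_comp ::
    "('a::metric_space \<times> bool \<Rightarrow> 'a \<times> bool \<Rightarrow> real) \<Rightarrow> ('a \<times> bool \<Rightarrow> 'a \<times> bool \<Rightarrow> real) \<Rightarrow>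
     'a \<times> bool \<Rightarrow> 'a \<times> bool \<Rightarrow> real" where
  "dm_comp \<rho> d = double (\<lambda>x z. INF y. d (x, False) (y, True) + \<rho> (y, False) (z, True))"

definition dm_adj ::
    "('a::metric_space \<times> bool \<Rightarrow> 'a \<times> bool \<Rightarrow> real) \<Rightarrow> 'a \<times> bool \<Rightarrow> 'a \<times> bool \<Rightarrow> real" where
  "dm_adj d = double (\<lambda>x y. d (y, False) (x, True))"

definition dm_unit :: "'a::metric_space \<times> bool \<Rightarrow> 'a \<times> bool \<Rightarrow> real" where
  "dm_unit = double (\<lambda>x y. dist x y + 1)"

text \<open>
  Invertibility of an element of the quotient \<open>double_metrics // dm_rel\<close>; by
  \<open>dm_invertible_class_iff\<close> below it does not depend on the representative.
\<close>

definition dm_invertible :: "('a::metric_space \<times> bool \<Rightarrow> 'a \<times> bool \<Rightarrow> real) set \<Rightarrow> bool" where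
  "dm_invertible a \<longleftrightarrow>
    (\<exists>d\<in>double_metrics. a = dm_class d \<and>
      dm_class (dm_comp (dm_adj d) d) = dm_class dm_unit \<and>
      dm_class (dm_comp d (dm_adj d)) = dm_class dm_unit)"


section \<open>Almost isometries\<close>

definition isometry_defect :: "('a::metric_space \<Rightarrow> 'a) \<Rightarrow> real \<Rightarrow> bool" where
  "isometry_defect f C \<longleftrightarrow>
    C > 0 \<and> (\<forall>x y. dist x y - C \<le> dist (f x) (f y) \<and> dist (f x) (f y) \<le> dist x y + C)"

definition almost_isometry :: "('a::metric_space \<Rightarrow> 'a) \<Rightarrow> bool" where
  "almost_isometry f \<longleftrightarrow>
    (\<exists>C. isometry_defect f C) \<and>
    (\<exists>g. \<exists>D>0. \<forall>x. dist (g (f x)) x < D \<and> dist (f (g x)) x < D)"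

definition dm_of_map ::
    "('a::metric_space \<Rightarrow> 'a) \<Rightarrow> real \<Rightarrow> 'a \<times> bool \<Rightarrow> 'a \<times> bool \<Rightarrow> real" where
  "dm_of_map f C = double (\<lambda>x y. INF z. dist x z + C + dist (f z) y)"


section \<open>Well-definedness\<close>

lemma double_simps [simp]:
  "double c (x, False) (y, True) = c x y"
  "double c (x, True) (y, False) = c y x"
  "double c (x, i) (y, i) = dist x y"
  by (auto simp: double_def)

lemma double_in_double_metrics:
  fixes c :: "'a::metric_space \<Rightarrow> 'a \<Rightarrow> real"
  assumes "e > 0" "\<And>x y. e \<le> c x y"
    and "\<And>x u y. c x y \<le> dist x u + c u y" "\<And>x y v. c x y \<le> c x v + dist v y"
    and "\<And>x u y. dist x u \<le> c x y + c u y" "\<And>x y v. dist y v \<le> c x y + c x v"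
  shows "double c \<in> double_metrics"
proof -
  have pos: "c x y > 0" for x y using assms(1) assms(2)[of x y] by linarith
  have "Metric_space UNIV (double c)"
  proof
    fix p q r :: "'a \<times> bool"
    obtain x i y j z k where s: "p = (x, i)" "q = (y, j)" "r = (z, k)"
      by (cases p; cases q; cases r)
    show "0 \<le> double c p q"
      using pos[THEN less_imp_le] by (auto simp: s double_def)
    show "double c p q = double c q p"
      by (auto simp: s double_def dist_commute)
    show "(double c p q = 0) = (p = q)"
      using pos by (auto simp: s double_def less_imp_neq[THEN not_sym])
    show "double c p r \<le> double c p q + double c q r"
      using assms(3)[of x z y] assms(4)[of x z y] assms(5)[of x z y] assms(6)[of x z y]
        assms(3)[of z x y] assms(4)[of z x y] dist_triangle[of x z y]
      by (cases i; cases j; cases k) (auto simp: s double_def dist_commute)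
  qed
  moreover have "e \<le> (INF p. double c (fst p, False) (snd p, True))"
    by (rule cINF_greatest) (use assms(2) in auto)
  ultimately show ?thesis
    using \<open>e > 0\<close> by (auto simp: double_metrics_def)
qed

lemma double_metricsD:
  assumes "d \<in> double_metrics"
  shows "d (x, False) (y, True) \<le> dist x u + d (u, False) (y, True)"
    and "d (x, False) (y, True) \<le> d (x, False) (v, True) + dist v y"
    and "dist x u \<le> d (x, False) (y, True) + d (u, False) (y, True)"
    and "dist y v \<le> d (x, False) (y, True) + d (x, False) (v, True)"
    and "0 \<le> d (x, False) (y, True)"
proof -
  interpret Metric_space UNIV d using assms by (simp add: double_metrics_def)
  have e: "d (x, False) (y, False) = dist x y" "d (x, True) (y, True) = dist x y" for x y
    using assms by (auto simp: double_metrics_def)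
  show "d (x, False) (y, True) \<le> dist x u + d (u, False) (y, True)"
    using triangle[of "(x, False)" "(u, False)" "(y, True)"] by (simp add: e)
  show "d (x, False) (y, True) \<le> d (x, False) (v, True) + dist v y"
    using triangle[of "(x, False)" "(v, True)" "(y, True)"] by (simp add: e)
  show "dist x u \<le> d (x, False) (y, True) + d (u, False) (y, True)"
    using triangle[of "(x, False)" "(y, True)" "(u, False)"] commute[of "(y, True)" "(u, False)"]
    by (simp add: e)
  show "dist y v \<le> d (x, False) (y, True) + d (x, False) (v, True)"
    using triangle[of "(y, True)" "(x, False)" "(v, True)"] commute[of "(y, True)" "(x, False)"]
    by (simp add: e)
  show "0 \<le> d (x, False) (y, True)" by simp
qed

lemma double_metrics_lower:
  assumes "d \<in> double_metrics"
  obtains e where "e > 0" "\<And>x y. e \<le> d (x, False) (y, True)"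
proof
  show "(INF p. d (fst p, False) (snd p, True)) > 0"
    using assms by (simp add: double_metrics_def)
  have bdd: "bdd_below (range (\<lambda>p. d (fst p, False) (snd p, True)))"
    by (rule bdd_belowI[of _ 0]) (auto simp: double_metricsD(5)[OF assms])
  show "(INF p. d (fst p, False) (snd p, True)) \<le> d (x, False) (y, True)" for x y
    using cINF_lower[OF bdd, of "(x, y)"] by simp
qed

lemma dm_unit_in [simp]: "dm_unit \<in> double_metrics"
  unfolding dm_unit_def
proof (rule double_in_double_metrics[of 1])
  fix x u y v :: 'a
  show "dist x y + 1 \<le> dist x u + (dist u y + 1)" using dist_triangle[of x y u] by simp
  show "dist x y + 1 \<le> dist x v + 1 + dist v y" using dist_triangle[of x y v] by simp
  show "dist x u \<le> dist x y + 1 + (dist u y + 1)" using dist_triangle2[of x u y] by simp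
  show "dist y v \<le> dist x y + 1 + (dist x v + 1)" using dist_triangle3[of y v x] by simp
qed auto

lemma dm_adj_in [simp]:
  assumes d: "d \<in> double_metrics"
  shows "dm_adj d \<in> double_metrics"
proof -
  obtain e where e: "e > 0" "\<And>x y. e \<le> d (x, False) (y, True)"
    using double_metrics_lower[OF d] by blast
  show ?thesis
    unfolding dm_adj_def
  proof (rule double_in_double_metrics[of e])
    fix x u y v :: 'a
    show "d (y, False) (x, True) \<le> dist x u + d (y, False) (u, True)"
      using double_metricsD(2)[OF d, of y x u] by (simp add: dist_commute)
    show "d (y, False) (x, True) \<le> d (v, False) (x, True) + dist v y"
      using double_metricsD(1)[OF d, of y x v] by (simp add: dist_commute)
  qed (use e double_metricsD[OF d] in auto)
qed

lemma dm_comp_le: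
  assumes "d \<in> double_metrics" "\<rho> \<in> double_metrics"
  shows "dm_comp \<rho> d (x, False) (z, True) \<le> d (x, False) (y, True) + \<rho> (y, False) (z, True)"
  unfolding dm_comp_def double_simps
proof (rule cINF_lower)
  show "bdd_below (range (\<lambda>y. d (x, False) (y, True) + \<rho> (y, False) (z, True)))"
    by (rule bdd_belowI[of _ 0]) (auto intro: add_nonneg_nonneg double_metricsD(5)[OF assms(1)] double_metricsD(5)[OF assms(2)])
qed simp

lemma dm_comp_ge:
  assumes "\<And>y. a \<le> d (x, False) (y, True) + \<rho> (y, False) (z, True)"
  shows "a \<le> dm_comp \<rho> d (x, False) (z, True)"
  unfolding dm_comp_def double_simps by (rule cINF_greatest) (use assms in auto)

lemma dm_comp_double:
  "dm_comp \<rho> d = double (\<lambda>x z. dm_comp \<rho> d (x, False) (z, True))"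
  by (simp add: dm_comp_def)

lemma dm_comp_in [simp]:
  assumes d: "d \<in> double_metrics" and r: "\<rho> \<in> double_metrics"
  shows "dm_comp \<rho> d \<in> double_metrics"
proof -
  let ?c = "\<lambda>x z. dm_comp \<rho> d (x, False) (z, True)"
  obtain e where e: "e > 0" "\<And>x y. e \<le> d (x, False) (y, True)"
    using double_metrics_lower[OF d] by blast
  note le = dm_comp_le[OF d r]
  note D = double_metricsD[OF d] and R = double_metricsD[OF r]
  have "double ?c \<in> double_metrics"
  proof (rule double_in_double_metrics[of e])
    fix x y u v :: 'a
    show "e \<le> ?c x y"
      by (rule dm_comp_ge) (metis e(2) R(5) add_increasing2)
    have "?c x y - dist x u \<le> ?c u y"
    proof (rule dm_comp_ge)
      show "?c x y - dist x u \<le> d (u, False) (w, True) + \<rho> (w, False) (y, True)" for w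
        using le[of x y w] D(1)[of x w u] by linarith
    qed
    then show "?c x y \<le> dist x u + ?c u y" by simp
    have "?c x y - dist v y \<le> ?c x v"
    proof (rule dm_comp_ge)
      show "?c x y - dist v y \<le> d (x, False) (w, True) + \<rho> (w, False) (v, True)" for w
        using le[of x y w] R(2)[of w y v] by linarith
    qed
    then show "?c x y \<le> ?c x v + dist v y" by simp
    have "dist x u - ?c u y \<le> ?c x y"
    proof (rule dm_comp_ge)
      fix w
      have "dist x u - (d (x, False) (w, True) + \<rho> (w, False) (y, True)) \<le> ?c u y"
      proof (rule dm_comp_ge)
        fix w'
        show "dist x u - (d (x, False) (w, True) + \<rho> (w, False) (y, True)) \<le>
            d (u, False) (w', True) + \<rho> (w', False) (y, True)"
          using D(3)[of x u w'] D(2)[of x w' w] R(3)[of w w' y] by linarith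
      qed
      then show "dist x u - ?c u y \<le> d (x, False) (w, True) + \<rho> (w, False) (y, True)" by simp
    qed
    then show "dist x u \<le> ?c x y + ?c u y" by simp
    have "dist y v - ?c x v \<le> ?c x y"
    proof (rule dm_comp_ge)
      fix w
      have "dist y v - (d (x, False) (w, True) + \<rho> (w, False) (y, True)) \<le> ?c x v"
      proof (rule dm_comp_ge)
        fix w'
        show "dist y v - (d (x, False) (w, True) + \<rho> (w, False) (y, True)) \<le>
            d (x, False) (w', True) + \<rho> (w', False) (v, True)"
          using R(4)[of y v w] R(1)[of w v w'] D(4)[of w w' x] by linarith
      qed
      then show "dist y v - ?c x v \<le> d (x, False) (w, True) + \<rho> (w, False) (y, True)" by simp
    qed
    then show "dist y v \<le> ?c x y + ?c x v" by simp
  qed (use e in auto)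
  then show ?thesis using dm_comp_double[of \<rho> d] by simp
qed

lemma dm_of_map_in:
  assumes "isometry_defect f C"
  shows "dm_of_map f C \<in> double_metrics"
proof -
  have C: "C > 0" "\<And>x y. dist x y - C \<le> dist (f x) (f y)" "\<And>x y. dist (f x) (f y) \<le> dist x y + C"
    using assms by (auto simp: isometry_defect_def)
  let ?c = "\<lambda>x y. INF z. dist x z + C + dist (f z) y"
  have le: "?c x y \<le> dist x z + C + dist (f z) y" for x y z
    by (rule cINF_lower) (use C(1) in \<open>auto intro!: bdd_belowI[of _ 0]\<close>)
  have ge: "a \<le> ?c x y" if "\<And>z. a \<le> dist x z + C + dist (f z) y" for a x y
    by (rule cINF_greatest) (use that in auto)
  show ?thesis
    unfolding dm_of_map_def
  proof (rule double_in_double_metrics[of C])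
    fix x y u v :: 'a
    show "C \<le> ?c x y" by (rule ge) simp
    have "?c x y - dist x u \<le> ?c u y"
    proof (rule ge)
      show "?c x y - dist x u \<le> dist u z + C + dist (f z) y" for z
        using le[of x y z] dist_triangle[of x z u] by linarith
    qed
    then show "?c x y \<le> dist x u + ?c u y" by simp
    have "?c x y - dist v y \<le> ?c x v"
    proof (rule ge)
      show "?c x y - dist v y \<le> dist x z + C + dist (f z) v" for z
        using le[of x y z] dist_triangle[of "f z" y v] by linarith
    qed
    then show "?c x y \<le> ?c x v + dist v y" by simp
    have "dist x u - ?c u y \<le> ?c x y"
    proof (rule ge)
      fix z
      have "dist x u - (dist x z + C + dist (f z) y) \<le> ?c u y"
      proof (rule ge)
        fix w
        show "dist x u - (dist x z + C + dist (f z) y) \<le> dist u w + C + dist (f w) y"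
          using C(1) C(2)[of z w] dist_triangle[of x u z] dist_triangle[of z u w]
            dist_triangle2[of "f z" "f w" y] dist_commute[of w u] by linarith
      qed
      then show "dist x u - ?c u y \<le> dist x z + C + dist (f z) y" by simp
    qed
    then show "dist x u \<le> ?c x y + ?c u y" by simp
    have "dist y v - ?c x v \<le> ?c x y"
    proof (rule ge)
      fix z
      have "dist y v - (dist x z + C + dist (f z) y) \<le> ?c x v"
      proof (rule ge)
        fix w
        show "dist y v - (dist x z + C + dist (f z) y) \<le> dist x w + C + dist (f w) v"
          using C(1) C(3)[of z w] dist_triangle[of y v "f z"] dist_triangle[of "f z" v "f w"]
            dist_triangle3[of z w x] dist_commute[of y "f z"] by linarith
      qed
      then show "dist y v - ?c x v \<le> dist x z + C + dist (f z) y" by simp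
    qed
    then show "dist y v \<le> ?c x y + ?c x v" by simp
  qed (use C in auto)
qed

lemma dm_rel_iff:
  "(d1, d2) \<in> dm_rel \<longleftrightarrow>
    d1 \<in> double_metrics \<and> d2 \<in> double_metrics \<and>
    (\<exists>a b. \<forall>x y. d2 (x, False) (y, True) \<le> a + b * d1 (x, False) (y, True)) \<and>
    (\<exists>a b. \<forall>x y. d1 (x, False) (y, True) \<le> a + b * d2 (x, False) (y, True))"
  (is "?L \<longleftrightarrow> ?M1 \<and> ?M2 \<and> ?A \<and> ?B")
proof
  assume ?L
  then obtain \<alpha> \<beta> where m: ?M1 ?M2 and \<beta>: "\<beta> \<ge> 1"
    and 1: "\<And>x y. - \<alpha> + 1 / \<beta> * d1 (x, False) (y, True) \<le> d2 (x, False) (y, True)"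
    and 2: "\<And>x y. d2 (x, False) (y, True) \<le> \<alpha> + \<beta> * d1 (x, False) (y, True)"
    by (auto simp: dm_rel_def)
  have "d1 (x, False) (y, True) \<le> \<beta> * \<alpha> + \<beta> * d2 (x, False) (y, True)" for x y
    using mult_left_mono[OF 1[of x y], of \<beta>] \<beta> by (simp add: algebra_simps)
  then show "?M1 \<and> ?M2 \<and> ?A \<and> ?B" using m 2 by blast
next
  assume R: "?M1 \<and> ?M2 \<and> ?A \<and> ?B"
  then obtain a b a' b' where m: ?M1 ?M2
    and 1: "\<And>x y. d2 (x, False) (y, True) \<le> a + b * d1 (x, False) (y, True)"
    and 2: "\<And>x y. d1 (x, False) (y, True) \<le> a' + b' * d2 (x, False) (y, True)" by blast
  define \<beta> where "\<beta> = 1 + \<bar>b\<bar> + \<bar>b'\<bar>"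
  define \<alpha> where "\<alpha> = 1 + \<bar>a\<bar> + \<bar>a'\<bar>"
  have c: "\<beta> \<ge> 1" "\<alpha> > 0" by (auto simp: \<alpha>_def \<beta>_def)
  have "- \<alpha> + 1 / \<beta> * d1 (x, False) (y, True) \<le> d2 (x, False) (y, True) \<and>
      d2 (x, False) (y, True) \<le> \<alpha> + \<beta> * d1 (x, False) (y, True)" for x y
  proof
    have n: "0 \<le> d1 (x, False) (y, True)" "0 \<le> d2 (x, False) (y, True)"
      using m double_metricsD(5) by auto
    have "b * d1 (x, False) (y, True) \<le> \<beta> * d1 (x, False) (y, True)"
      by (rule mult_right_mono) (use n in \<open>auto simp: \<beta>_def\<close>)
    then show "d2 (x, False) (y, True) \<le> \<alpha> + \<beta> * d1 (x, False) (y, True)"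
      using 1[of x y] by (simp add: \<alpha>_def)
    have "b' * d2 (x, False) (y, True) \<le> \<beta> * d2 (x, False) (y, True)"
      by (rule mult_right_mono) (use n in \<open>auto simp: \<beta>_def\<close>)
    moreover have "\<alpha> \<le> \<beta> * \<alpha>" using mult_right_mono[of 1 \<beta> \<alpha>] c by simp
    ultimately have "d1 (x, False) (y, True) \<le> \<beta> * (\<alpha> + d2 (x, False) (y, True))"
      using 2[of x y] by (simp add: \<alpha>_def algebra_simps)
    then show "- \<alpha> + 1 / \<beta> * d1 (x, False) (y, True) \<le> d2 (x, False) (y, True)"
      using c by (simp add: field_simps)
  qed
  then show ?L using m c by (auto simp: dm_rel_def)
qed

lemma affine_bound_trans:
  fixes f g h :: "'b \<Rightarrow> real"
  assumes "\<exists>a b. \<forall>x. f x \<le> a + b * g x" "\<exists>a b. \<forall>x. g x \<le> a + b * h x" "\<And>x. 0 \<le> g x"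
  shows "\<exists>a b. \<forall>x. f x \<le> a + b * h x"
proof -
  obtain a b a' b' where 1: "\<And>x. f x \<le> a + b * g x" and 2: "\<And>x. g x \<le> a' + b' * h x"
    using assms by blast
  have "f x \<le> (a + \<bar>b\<bar> * a') + (\<bar>b\<bar> * b') * h x" for x
  proof -
    have "f x \<le> a + \<bar>b\<bar> * g x"
      using 1[of x] mult_right_mono[OF abs_ge_self[of b] assms(3)[of x]] by linarith
    also have "\<bar>b\<bar> * g x \<le> \<bar>b\<bar> * (a' + b' * h x)" by (rule mult_left_mono[OF 2]) simp
    finally show ?thesis by (simp add: algebra_simps)
  qed
  then show ?thesis by blast
qed

lemma equiv_dm_rel:
  "equiv (double_metrics :: ('a::metric_space \<times> bool \<Rightarrow> 'a \<times> bool \<Rightarrow> real) set) dm_rel"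
proof (rule equivI)
  show "dm_rel \<subseteq> double_metrics \<times> double_metrics" by (auto simp: dm_rel_def)
  show "refl_on double_metrics dm_rel"
    by (rule refl_onI) (auto simp: dm_rel_iff intro!: exI[of _ 0] exI[of _ 1])
  show "sym dm_rel" by (rule symI) (auto simp: dm_rel_iff)
  show "trans (dm_rel :: (('a \<times> bool \<Rightarrow> 'a \<times> bool \<Rightarrow> real) \<times> _) set)"
  proof (rule transI)
    fix d1 d2 d3 :: "'a \<times> bool \<Rightarrow> 'a \<times> bool \<Rightarrow> real"
    assume r: "(d1, d2) \<in> dm_rel" "(d2, d3) \<in> dm_rel"
    let ?F = "\<lambda>d :: 'a \<times> bool \<Rightarrow> 'a \<times> bool \<Rightarrow> real. \<lambda>p. d (fst p, False) (snd p, True)"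
    have "\<exists>a b. \<forall>p. ?F d3 p \<le> a + b * ?F d1 p"
      by (rule affine_bound_trans[of _ "?F d2"])
        (use r in \<open>auto simp: dm_rel_iff double_metricsD(5)\<close>)
    moreover have "\<exists>a b. \<forall>p. ?F d1 p \<le> a + b * ?F d3 p"
      by (rule affine_bound_trans[of _ "?F d2"])
        (use r in \<open>auto simp: dm_rel_iff double_metricsD(5)\<close>)
    ultimately show "(d1, d3) \<in> dm_rel" using r by (auto simp: dm_rel_iff)
  qed
qed

lemma dm_class_eq_iff:
  assumes "d1 \<in> double_metrics" "d2 \<in> double_metrics"
  shows "dm_class d1 = dm_class d2 \<longleftrightarrow> (d1, d2) \<in> dm_rel"
  unfolding dm_class_def using eq_equiv_class_iff[OF equiv_dm_rel assms] .

lemma dm_comp_bound: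
  assumes m: "d1 \<in> double_metrics" "d2 \<in> double_metrics" "\<rho>1 \<in> double_metrics" "\<rho>2 \<in> double_metrics"
    and d: "\<And>x y. d2 (x, False) (y, True) \<le> a + b * d1 (x, False) (y, True)"
    and r: "\<And>x y. \<rho>2 (x, False) (y, True) \<le> a' + b' * \<rho>1 (x, False) (y, True)"
  shows "\<exists>a b. \<forall>x z. dm_comp \<rho>2 d2 (x, False) (z, True) \<le> a + b * dm_comp \<rho>1 d1 (x, False) (z, True)"
proof (intro exI allI)
  fix x z
  let ?b = "1 + \<bar>b\<bar> + \<bar>b'\<bar>"
  have "(dm_comp \<rho>2 d2 (x, False) (z, True) - (a + a')) / ?b \<le> dm_comp \<rho>1 d1 (x, False) (z, True)"
  proof (rule dm_comp_ge)
    fix y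
    have "b * d1 (x, False) (y, True) \<le> ?b * d1 (x, False) (y, True)"
      by (rule mult_right_mono) (auto simp: double_metricsD(5) m)
    moreover have "b' * \<rho>1 (y, False) (z, True) \<le> ?b * \<rho>1 (y, False) (z, True)"
      by (rule mult_right_mono) (auto simp: double_metricsD(5) m)
    ultimately have "dm_comp \<rho>2 d2 (x, False) (z, True) - (a + a') \<le>
        ?b * (d1 (x, False) (y, True) + \<rho>1 (y, False) (z, True))"
      using d[of x y] r[of y z] dm_comp_le[OF m(2,4), of x z y]
      unfolding distrib_left by linarith
    then show "(dm_comp \<rho>2 d2 (x, False) (z, True) - (a + a')) / ?b \<le>
        d1 (x, False) (y, True) + \<rho>1 (y, False) (z, True)"
      by (subst pos_divide_le_eq) (auto simp: mult.commute intro: add_pos_nonneg)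
  qed
  then have "dm_comp \<rho>2 d2 (x, False) (z, True) - (a + a') \<le>
      dm_comp \<rho>1 d1 (x, False) (z, True) * ?b"
    by (subst (asm) pos_divide_le_eq) (auto intro: add_pos_nonneg)
  then show "dm_comp \<rho>2 d2 (x, False) (z, True) \<le>
      (a + a') + ?b * dm_comp \<rho>1 d1 (x, False) (z, True)"
    by (simp add: mult.commute)
qed

lemma dm_comp_cong:
  assumes "(d1, d2) \<in> dm_rel" "(\<rho>1, \<rho>2) \<in> dm_rel"
  shows "(dm_comp \<rho>1 d1, dm_comp \<rho>2 d2) \<in> dm_rel"
  using assms unfolding dm_rel_iff
  by (elim conjE exE, intro conjI) (auto intro!: dm_comp_bound)

lemma dm_adj_cong:
  assumes "(d1, d2) \<in> dm_rel"
  shows "(dm_adj d1, dm_adj d2) \<in> dm_rel"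
proof -
  have "dm_adj e (x, False) (y, True) = e (y, False) (x, True)"
    for e :: "'a \<times> bool \<Rightarrow> 'a \<times> bool \<Rightarrow> real" and x y
    by (simp add: dm_adj_def)
  then show ?thesis
    using assms unfolding dm_rel_iff by (simp only: dm_adj_in) blast
qed

lemma dm_invertible_class_iff:
  assumes d: "d \<in> double_metrics"
  shows "dm_invertible (dm_class d) \<longleftrightarrow>
    dm_class (dm_comp (dm_adj d) d) = dm_class dm_unit \<and>
    dm_class (dm_comp d (dm_adj d)) = dm_class dm_unit"
proof -
  have "dm_class (dm_comp (dm_adj d) d) = dm_class (dm_comp (dm_adj e) e) \<and>
      dm_class (dm_comp d (dm_adj d)) = dm_class (dm_comp e (dm_adj e))"
    if e: "e \<in> double_metrics" "dm_class d = dm_class e" for e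
  proof -
    have "(d, e) \<in> dm_rel" using e d by (simp add: dm_class_eq_iff)
    then show ?thesis using d e(1) by (simp add: dm_class_eq_iff dm_comp_cong dm_adj_cong)
  qed
  then show ?thesis unfolding dm_invertible_def using d by metis
qed

lemma dm_class_of_map_indep:
  assumes C: "isometry_defect f C" and C': "isometry_defect f C'"
  shows "dm_class (dm_of_map f C) = dm_class (dm_of_map f C')"
proof -
  have bound: "dm_of_map f A (x, False) (y, True) \<le> (A - B) + 1 * dm_of_map f B (x, False) (y, True)"
    if "isometry_defect f A" for A B x y
  proof -
    have "dm_of_map f A (x, False) (y, True) - (A - B) \<le> dm_of_map f B (x, False) (y, True)"
      unfolding dm_of_map_def double_simps
    proof (rule cINF_greatest)
      fix z
      have "(INF z. dist x z + A + dist (f z) y) \<le> dist x z + A + dist (f z) y"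
        by (rule cINF_lower)
          (use that in \<open>auto intro!: bdd_belowI[of _ 0] simp: isometry_defect_def\<close>)
      then show "(INF z. dist x z + A + dist (f z) y) - (A - B) \<le> dist x z + B + dist (f z) y"
        by simp
    qed simp
    then show ?thesis by simp
  qed
  show ?thesis
    using dm_of_map_in[OF C] dm_of_map_in[OF C'] bound[OF C, of _ _ C'] bound[OF C', of _ _ C]
    by (subst dm_class_eq_iff) (auto simp only: dm_rel_iff)
qed

end

theory Submission
  imports Defs
begin

text \<open>
  On the diagonal, \<open>d\<^sup>*d \<sim> I\<close> says that every point \<open>x\<close> lies at uniformly bounded distance from
  some \<open>f(x)'\<close>, and \<open>dd\<^sup>* \<sim> I\<close> that every \<open>y'\<close> lies at uniformly bounded distance from some
  \<open>g(y)\<close>. The triangle inequality makes \<open>f\<close> an almost isometry with quasi-inverse \<open>g\<close>.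
\<close>

text \<open>Equivalence bounds \<open>e\<close> by an affine function of \<open>dm_unit\<close>,
  which is constantly 1 on the diagonal. The strict form suits the extraction of points from
  infima.\<close>

lemma dm_class_eq_unit_diagonal_bounded:
  assumes "e \<in> double_metrics" "dm_class e = dm_class dm_unit"
  obtains K where "\<And>x. e (x, False) (x, True) < K"
proof -
  have "(dm_unit, e) \<in> dm_rel"
    using assms dm_class_eq_iff[of dm_unit e] by simp
  then obtain a b where "\<And>x y. e (x, False) (y, True) \<le> a + b * dm_unit (x, False) (y, True)"
    unfolding dm_rel_iff by blast
  then have "e (x, False) (x, True) \<le> a + b" for x
    unfolding dm_unit_def double_simps by (metis dist_self add_0 mult.right_neutral)
  then have "e (x, False) (x, True) < a + b + 1" for x
    by (rule le_less_trans) simp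
  then show thesis
    by (rule that)
qed

text \<open>The infimum defining the composition need not be attained, but some midpoint lies below
  any strict upper bound.\<close>

lemma dm_comp_less_obtains:
  assumes "dm_comp \<rho> d (x, False) (z, True) < K"
  obtains y where "d (x, False) (y, True) + \<rho> (y, False) (z, True) < K"
  using assms dm_comp_ge[of K d x \<rho> z] by (meson not_le)

lemma dm_of_map_le:
  assumes "isometry_defect f C"
  shows "dm_of_map f C (x, False) (y, True) \<le> dist x z + C + dist (f z) y"
  unfolding dm_of_map_def double_simps
  by (rule cINF_lower)
    (use assms in \<open>auto intro!: bdd_belowI[of _ 0] simp: isometry_defect_def\<close>)

lemma dm_of_map_ge:
  assumes "\<And>z. a \<le> dist x z + C + dist (f z) y"
  shows "a \<le> dm_of_map f C (x, False) (y, True)"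
  unfolding dm_of_map_def double_simps by (rule cINF_greatest) (use assms in auto)

text \<open>The two metrics differ by a bounded amount, so they are equivalent with slope 1.\<close>

lemma dm_class_of_map_eqI:
  assumes d: "d \<in> double_metrics"
    and f: "\<And>x. d (x, False) (f x, True) \<le> K"
    and C: "isometry_defect f C"
  shows "dm_class (dm_of_map f C) = dm_class d"
proof -
  \<comment> \<open>Test the infimum at \<open>z = x\<close>, then bound \<open>dist (f x) y\<close>
    by going from \<open>f x\<close> to \<open>y\<close> in the second copy via \<open>x\<close> in
    the first.\<close>
  have "dm_of_map f C (x, False) (y, True) \<le> (C + K) + 1 * d (x, False) (y, True)" for x y
    using dm_of_map_le[OF C, of x y x] double_metricsD(4)[OF d, of "f x" y x] f[of x] by simp
  moreover have "d (x, False) (y, True) \<le> K + 1 * dm_of_map f C (x, False) (y, True)" for x y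
  proof -
    have "d (x, False) (y, True) - K \<le> dm_of_map f C (x, False) (y, True)"
    proof (rule dm_of_map_ge)
      \<comment> \<open>In the double, go from \<open>x\<close> to \<open>z\<close>, cross to the
        copy of \<open>f z\<close> at cost at most \<open>K\<close>, then go to
        \<open>y\<close>.\<close>
      show "d (x, False) (y, True) - K \<le> dist x z + C + dist (f z) y" for z
        using double_metricsD(1)[OF d, of x y z] double_metricsD(2)[OF d, of z y "f z"] f[of z] C
        by (simp add: isometry_defect_def)
    qed
    then show ?thesis by simp
  qed
  ultimately show ?thesis
    using d dm_of_map_in[OF C] by (subst dm_class_eq_iff) (auto simp only: dm_rel_iff)
qed

text \<open>Crossing between the copies costs less than \<open>K\<close> at each endpoint, hence the
  defect \<open>2 * K\<close>. Both \<open>g (f x)\<close> and \<open>x\<close> are within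
  \<open>K\<close> of the second copy of \<open>f x\<close>; the other composite is
  symmetric.\<close>

lemma almost_isometryI_close:
  assumes d: "d \<in> double_metrics"
    and f: "\<And>x. d (x, False) (f x, True) < K"
    and g: "\<And>y. d (g y, False) (y, True) < K"
  shows "almost_isometry f"
proof -
  note D = double_metricsD[OF d]
  have K: "K > 0"
    using f D(5) le_less_trans by blast
  have "isometry_defect f (2 * K)"
    unfolding isometry_defect_def
  proof (intro conjI allI)
    fix x y
    show "dist x y - 2 * K \<le> dist (f x) (f y)"
      using D(3)[of x y "f y"] D(2)[of x "f y" "f x"] f[of x] f[of y] by linarith
    show "dist (f x) (f y) \<le> dist x y + 2 * K"
      using D(4)[of "f x" "f y" x] D(1)[of x "f y" y] f[of x] f[of y] by linarith
  qed (use K in simp)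
  moreover have "dist (g (f x)) x < 2 * K \<and> dist (f (g x)) x < 2 * K" for x
    using D(3)[of "g (f x)" x "f x"] D(4)[of "f (g x)" x "g x"]
      f[of x] f[of "g x"] g[of x] g[of "f x"] by linarith
  ultimately show ?thesis
    unfolding almost_isometry_def using K
    by (intro conjI exI[of _ "2 * K"] exI[of _ g]) auto
qed

theorem proposition9p2:
  fixes d :: "'a::metric_space \<times> bool \<Rightarrow> 'a \<times> bool \<Rightarrow> real"
  assumes "d \<in> double_metrics"
    and "dm_invertible (dm_class d)"
  shows "\<exists>f. almost_isometry f \<and>
    (\<forall>C. isometry_defect f C \<longrightarrow> dm_class (dm_of_map f C) = dm_class d)"
proof -
  note d = assms(1)
  have inv: "dm_class (dm_comp (dm_adj d) d) = dm_class dm_unit"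
    "dm_class (dm_comp d (dm_adj d)) = dm_class dm_unit"
    using assms dm_invertible_class_iff by blast+
  have adj: "dm_adj d (x, False) (y, True) = d (y, False) (x, True)" for x y
    by (simp add: dm_adj_def)
  obtain K where K: "\<And>x. dm_comp (dm_adj d) d (x, False) (x, True) < K"
    using dm_class_eq_unit_diagonal_bounded[OF _ inv(1)] d by auto
  obtain L where L: "\<And>x. dm_comp d (dm_adj d) (x, False) (x, True) < L"
    using dm_class_eq_unit_diagonal_bounded[OF _ inv(2)] d by auto
  define M where "M = max K L"
  have "\<exists>y. d (x, False) (y, True) < M" for x
  proof -
    \<comment> \<open>By the definition of the adjoint both summands equal
      \<open>d (x, False) (y, True)\<close>, so each is below \<open>K\<close>.\<close>
    obtain y where "d (x, False) (y, True) + dm_adj d (y, False) (x, True) < K"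
      using K by (rule dm_comp_less_obtains)
    then have "d (x, False) (y, True) < M"
      using double_metricsD(5)[OF d, of x y] by (simp add: adj M_def)
    then show ?thesis ..
  qed
  then obtain f where f: "\<And>x. d (x, False) (f x, True) < M"
    by metis
  have "\<exists>x. d (x, False) (y, True) < M" for y
  proof -
    obtain x where "dm_adj d (y, False) (x, True) + d (x, False) (y, True) < L"
      using L by (rule dm_comp_less_obtains)
    then have "d (x, False) (y, True) < M"
      using double_metricsD(5)[OF d, of x y] by (simp add: adj M_def)
    then show ?thesis ..
  qed
  then obtain g where g: "\<And>y. d (g y, False) (y, True) < M"
    by metis
  have "almost_isometry f"
    using d f g by (rule almost_isometryI_close)
  moreover have "dm_class (dm_of_map f C) = dm_class d" if "isometry_defect f C" for C
    using d less_imp_le[OF f] that by (rule dm_class_of_map_eqI)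
  ultimately show ?thesis
    by blast
qed

end
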